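(* Let $(Z_n,\mathcal{P}_n,\mathcal{E}_n)_{n\in\mathbb{N}}$ be an approximation sequence of the Banach space $Z$, with constants $\mu_{\mathrm{p}},\mu_{\mathrm{e}}>0$ such that $\|\mathcal{P}_n\|_{\mathcal{L}(Z,Z_n)}\le\mu_{\mathrm{p}}$ and $\|\mathcal{E}_n\|_{\mathcal{L}(Z_n,Z)}\le\mu_{\mathrm{e}}$ for all $n\in\mathbb{N}$. Consider semigroups of (bounded linear) operators $\mathcal{S}(t)$ on $Z$ and $\mathcal{S}_n(t)$ on $Z_n$ for $n\in\mathbb{N}$, with growth bounds $\|\mathcal{S}_n(t)\|_{\mathcal{L}(Z_n)}\le M_ne^{\omega_nt}$ for all $t\ge 0$. Assume that (i) $(\mathcal{S}_n(t))_{n\in\mathbb{N}}$ converges to $\mathcal{S}(t)$, and (ii) $(M_n)_{n\in\mathbb{N}}$ and $(\omega_n)_{n\in\mathbb{N}}$ are Cauchy sequences (of real numbers). Then $\|\mathcal{S}(t)\|_{\mathcal{L}(Z)}\le M^\star e^{\omega^\star t}$ for all $t\ge0$, where $$\omega^\star:=\lim_{n\to\infty}\omega_n,\qquad M^\star:=\mu_{\mathrm{p}}\,\mu_{\mathrm{e}}\,\tilde M,\qquad \tilde M:=\lim_{n\to\infty}M_n.$$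
   Context: $\mathcal{L}(X,Y)$ denotes the bounded linear operators from $X$ to $Y$, and $\mathcal{L}(X)=\mathcal{L}(X,X)$. Approximation sequence: a sequence of triples $(Z_n,\mathcal{P}_n,\mathcal{E}_n)_{n\in\mathbb{N}}$, each consisting of a Banach space $(Z_n,\|\cdot\|_{Z_n})$, a bounded linear operator $\mathcal{P}_n\colon Z\to Z_n$ and a (bounded linear) right-inverse $\mathcal{E}_n\colon Z_n\to Z$ of $\mathcal{P}_n$ (so $\mathcal{P}_n\mathcal{E}_n=\mathrm{id}_{Z_n}$), is an approximation sequence for $Z$ if (1) $\lim_{n\to\infty}\|\mathcal{P}_nz\|_{Z_n}=\|z\|_Z$ for every $z\in Z$, and (2) there exist constants $\mu_{\mathrm{p}},\mu_{\mathrm{e}}>0$ with $\|\mathcal{P}_n\|_{\mathcal{L}(Z,Z_n)}\le\mu_{\mathrm{p}}$ and $\|\mathcal{E}_n\|_{\mathcal{L}(Z_n,Z)}\le\mu_{\mathrm{e}}$ for all $n\in\mathbb{N}$. Convergence of vectors: $z_n\in Z_n$ converges to $z\in Z$, written $\lim_{n\to\infty}z_n=z$, if $\|\mathcal{P}_nz-z_n\|_{Z_n}\to0$ as $n\to\infty$. Convergence of semigroups: $(\mathcal{S}_n(t))_{n\in\mathbb{N}}$ converges to $\mathcal{S}(t)$ if $\lim_{n\to\infty}\mathcal{E}_n\mathcal{S}_n(t)z_n=\mathcal{S}(t)z$ in $Z$ for all $t\ge0$ and all $z_n\in Z_n$, $z\in Z$ with $\lim_{n\to\infty}z_n=z$ in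 the sense that $\|\mathcal{P}_nz-z_n\|_{Z_n}\to0$ as $n\to\infty$. *)

theory Defs
  imports "HOL-Analysis.Analysis" "HOL-Algebra.Module"
begin

text \<open>
  The spaces of an approximation sequence vary with \<open>n\<close>, so Banach spaces are structures
  on a carrier set: modules in the sense of \<open>HOL-Algebra\<close>, with a norm added.
  The record fields \<open>mult\<close> and \<open>one\<close>, inherited from the ring record, are never used.
  Since \<open>real_normed_field\<close> only has instances isomorphic to the reals and to the complex
  numbers, the type variable \<open>'k\<close> covers exactly real and complex Banach spaces.
\<close>

definition scalars :: "'k::real_normed_field ring" where
  "scalars = \<lparr>carrier = UNIV, mult = (*), one = 1, zero = 0, add = (+)\<rparr>"

record ('k, 'a) normed_space = "('k, 'a) module" +
  vnorm :: "'a \<Rightarrow> real"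

text \<open>The distance is cut off outside the carrier because the locale \<open>Metric_space\<close> asks for
  nonnegativity and symmetry on the whole type.\<close>

definition vdist :: "('k, 'a) normed_space \<Rightarrow> 'a \<Rightarrow> 'a \<Rightarrow> real" where
  "vdist X x y =
    (if x \<in> carrier X \<and> y \<in> carrier X then vnorm X (x \<ominus>\<^bsub>X\<^esub> y) else 0)"

locale normed_space = Module.module "scalars :: 'k ring" X
  for X :: "('k::real_normed_field, 'a) normed_space" (structure) +
  assumes vnorm_nonneg: "x \<in> carrier X \<Longrightarrow> 0 \<le> vnorm X x"
    and vnorm_eq_zero: "x \<in> carrier X \<Longrightarrow> vnorm X x = 0 \<longleftrightarrow> x = \<zero>\<^bsub>X\<^esub>"
    and vnorm_smult: "x \<in> carrier X \<Longrightarrow> vnorm X (a \<odot>\<^bsub>X\<^esub> x) = norm a * vnorm X x"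
    and vnorm_triangle:
      "\<lbrakk>x \<in> carrier X; y \<in> carrier X\<rbrakk> \<Longrightarrow> vnorm X (x \<oplus>\<^bsub>X\<^esub> y) \<le> vnorm X x + vnorm X y"

locale banach_space = normed_space +
  assumes complete: "Metric_space.mcomplete (carrier X) (vdist X)"

lemma cring_scalars: "cring (scalars :: 'k::real_normed_field ring)"
proof -
  have "\<exists>y. y + x = 0" for x :: 'k
    by (rule exI[of _ "- x"]) simp
  then show ?thesis
    by (intro cringI abelian_groupI comm_monoidI) (auto simp: scalars_def algebra_simps)
qed

lemma (in normed_space) Metric_space_vdist: "Metric_space (carrier X) (vdist X)"
proof
  show "0 \<le> vdist X x y" for x y
    by (simp add: vdist_def vnorm_nonneg)
  show "vdist X x y = vdist X y x" for x y
  proof (cases "x \<in> carrier X \<and> y \<in> carrier X")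
    case True
    then have xy: "x \<in> carrier X" "y \<in> carrier X" by auto
    have m1: "\<ominus>\<^bsub>scalars\<^esub> \<one>\<^bsub>scalars\<^esub> = (- 1 :: 'k)"
      by (rule R.minus_equality) (auto simp: scalars_def)
    have "y \<ominus>\<^bsub>X\<^esub> x = \<ominus>\<^bsub>X\<^esub> (x \<ominus>\<^bsub>X\<^esub> y)"
      using xy by (simp add: a_minus_def M.minus_add M.a_comm)
    also have "\<dots> = (\<ominus>\<^bsub>scalars\<^esub> \<one>\<^bsub>scalars\<^esub>) \<odot>\<^bsub>X\<^esub> (x \<ominus>\<^bsub>X\<^esub> y)"
      using xy by (simp add: smult_l_minus)
    finally have "y \<ominus>\<^bsub>X\<^esub> x = (- 1) \<odot>\<^bsub>X\<^esub> (x \<ominus>\<^bsub>X\<^esub> y)"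
      by (simp only: m1)
    then show ?thesis
      using xy by (simp add: vdist_def vnorm_smult)
  qed (auto simp: vdist_def)
  show "vdist X x y = 0 \<longleftrightarrow> x = y" if "x \<in> carrier X" "y \<in> carrier X" for x y
  proof
    assume "vdist X x y = 0"
    then have "x \<oplus>\<^bsub>X\<^esub> (\<ominus>\<^bsub>X\<^esub> y) = \<zero>\<^bsub>X\<^esub>"
      using that by (simp add: vdist_def vnorm_eq_zero flip: a_minus_def)
    then have "\<ominus>\<^bsub>X\<^esub> (\<ominus>\<^bsub>X\<^esub> y) = x"
      using that by (intro M.minus_equality) auto
    then show "x = y"
      using that by simp
  next
    assume "x = y"
    then show "vdist X x y = 0"
      using that by (simp add: vdist_def vnorm_eq_zero a_minus_def M.r_neg)
  qed
  show "vdist X x z \<le> vdist X x y + vdist X y z"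
    if xyz: "x \<in> carrier X" "y \<in> carrier X" "z \<in> carrier X" for x y z
  proof -
    have "x \<ominus>\<^bsub>X\<^esub> z = (x \<ominus>\<^bsub>X\<^esub> y) \<oplus>\<^bsub>X\<^esub> (y \<ominus>\<^bsub>X\<^esub> z)"
      using xyz by (simp add: a_minus_def M.a_assoc M.r_neg1)
    then show ?thesis
      using xyz vnorm_triangle[of "x \<ominus>\<^bsub>X\<^esub> y" "y \<ominus>\<^bsub>X\<^esub> z"] by (simp add: vdist_def)
  qed
qed

text \<open>Operators are functions considered on the carrier of the source space only.\<close>

definition bounded_operators ::
    "('k::real_normed_field, 'a) normed_space \<Rightarrow> ('k, 'b) normed_space \<Rightarrow> ('a \<Rightarrow> 'b) set"
  where
  "bounded_operators X Y = {T.
     T \<in> carrier X \<rightarrow> carrier Y \<and>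
     (\<forall>x\<in>carrier X. \<forall>y\<in>carrier X. T (x \<oplus>\<^bsub>X\<^esub> y) = T x \<oplus>\<^bsub>Y\<^esub> T y) \<and>
     (\<forall>a. \<forall>x\<in>carrier X. T (a \<odot>\<^bsub>X\<^esub> x) = a \<odot>\<^bsub>Y\<^esub> T x) \<and>
     (\<exists>K. \<forall>x\<in>carrier X. vnorm Y (T x) \<le> K * vnorm X x)}"

text \<open>As in the library's \<open>onorm\<close>, the zero vector contributes the value \<open>0 / 0 = 0\<close>.\<close>

definition op_norm ::
    "('k, 'a) normed_space \<Rightarrow> ('k, 'b) normed_space \<Rightarrow> ('a \<Rightarrow> 'b) \<Rightarrow> real" where
  "op_norm X Y T = (SUP x\<in>carrier X. vnorm Y (T x) / vnorm X x)"

definition approximation_sequence ::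
    "('k::real_normed_field, 'a) normed_space \<Rightarrow> (nat \<Rightarrow> ('k, 'b) normed_space) \<Rightarrow>
      (nat \<Rightarrow> 'a \<Rightarrow> 'b) \<Rightarrow> (nat \<Rightarrow> 'b \<Rightarrow> 'a) \<Rightarrow> bool" where
  "approximation_sequence Z Zn P E \<longleftrightarrow>
     (\<forall>n. banach_space (Zn n) \<and>
          P n \<in> bounded_operators Z (Zn n) \<and>
          E n \<in> bounded_operators (Zn n) Z \<and>
          (\<forall>x\<in>carrier (Zn n). P n (E n x) = x)) \<and>
     (\<forall>z\<in>carrier Z. (\<lambda>n. vnorm (Zn n) (P n z)) \<longlonglongrightarrow> vnorm Z z) \<and>
     (\<exists>\<mu>p>0. \<exists>\<mu>e>0. \<forall>n.
        op_norm Z (Zn n) (P n) \<le> \<mu>p \<and> op_norm (Zn n) Z (E n) \<le> \<mu>e)"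

definition vectors_converge ::
    "(nat \<Rightarrow> ('k, 'b) normed_space) \<Rightarrow> (nat \<Rightarrow> 'a \<Rightarrow> 'b) \<Rightarrow> (nat \<Rightarrow> 'b) \<Rightarrow> 'a \<Rightarrow> bool"
  where
  "vectors_converge Zn P zn z \<longleftrightarrow>
     (\<lambda>n. vnorm (Zn n) (P n z \<ominus>\<^bsub>Zn n\<^esub> zn n)) \<longlonglongrightarrow> 0"

text \<open>No continuity in \<open>t\<close> is required. Values at negative times are irrelevant.\<close>

definition operator_semigroup ::
    "('k::real_normed_field, 'a) normed_space \<Rightarrow> (real \<Rightarrow> 'a \<Rightarrow> 'a) \<Rightarrow> bool" where
  "operator_semigroup X S \<longleftrightarrow>
     (\<forall>t\<ge>0. S t \<in> bounded_operators X X) \<and>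
     (\<forall>x\<in>carrier X. S 0 x = x) \<and>
     (\<forall>s\<ge>0. \<forall>t\<ge>0. \<forall>x\<in>carrier X. S (s + t) x = S s (S t x))"

definition semigroups_converge ::
    "('k, 'a) normed_space \<Rightarrow> (nat \<Rightarrow> ('k, 'b) normed_space) \<Rightarrow>
      (nat \<Rightarrow> 'a \<Rightarrow> 'b) \<Rightarrow> (nat \<Rightarrow> 'b \<Rightarrow> 'a) \<Rightarrow>
      (nat \<Rightarrow> real \<Rightarrow> 'b \<Rightarrow> 'b) \<Rightarrow> (real \<Rightarrow> 'a \<Rightarrow> 'a) \<Rightarrow> bool" where
  "semigroups_converge Z Zn P E Sn S \<longleftrightarrow>
     (\<forall>t\<ge>0. \<forall>zn z.
        (\<forall>n. zn n \<in> carrier (Zn n)) \<longrightarrow> z \<in> carrier Z \<longrightarrow> vectors_converge Zn P zn z \<longrightarrow>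
        (\<lambda>n. vnorm Z (E n (Sn n t (zn n)) \<ominus>\<^bsub>Z\<^esub> S t z)) \<longlonglongrightarrow> 0)"

end

theory Submission
  imports Defs
begin

text \<open>
  A vector \<open>z\<close> of \<open>Z\<close> is the limit of its own projections \<open>P n z\<close>, trivially.
  Convergence of the semigroups along this particular sequence says that
  \<open>E n (Sn n t (P n z))\<close> tends to \<open>S t z\<close> in \<open>Z\<close>. The approximants are compositions of three
  operators with bounded norms, so they are bounded by
  \<open>\<mu>e * (M n * exp (\<omega> n * t)) * \<mu>p * vnorm Z z\<close>. Continuity of the norm of \<open>Z\<close> passes
  this bound to the limit: Cauchy sequences of reals converge, and the bound depends
  continuously on \<open>M n\<close> and \<open>\<omega> n\<close>. Finally, a pointwise bound with a nonnegative
  constant is a bound on the operator norm; the constant here is nonnegative as a limit of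
  positive multiples of upper bounds for the norms of the \<open>Sn n t\<close>.
\<close>

lemma bounded_operators_closed:
  assumes "T \<in> bounded_operators X Y" and "x \<in> carrier X"
  shows "T x \<in> carrier Y"
  using assms unfolding bounded_operators_def by blast

lemma bdd_above_op_norm_quotients:
  assumes "normed_space X" and T: "T \<in> bounded_operators X Y"
  shows "bdd_above ((\<lambda>x. vnorm Y (T x) / vnorm X x) ` carrier X)"
proof -
  interpret X: normed_space X by fact
  obtain K where K: "\<And>x. x \<in> carrier X \<Longrightarrow> vnorm Y (T x) \<le> K * vnorm X x"
    using T unfolding bounded_operators_def by blast
  have "vnorm Y (T x) / vnorm X x \<le> \<bar>K\<bar>" if x: "x \<in> carrier X" for x
  proof (cases "vnorm X x = 0")
    case False
    then have "0 < vnorm X x"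
      using X.vnorm_nonneg[OF x] by simp
    then have "vnorm Y (T x) / vnorm X x \<le> K"
      using K[OF x] by (simp add: pos_divide_le_eq)
    then show ?thesis by simp
  qed simp
  then show ?thesis
    by (auto intro!: bdd_aboveI)
qed

lemma op_norm_nonneg:
  assumes "normed_space X" and "T \<in> bounded_operators X Y"
  shows "0 \<le> op_norm X Y T"
proof -
  interpret X: normed_space X by fact
  have zero: "\<zero>\<^bsub>X\<^esub> \<in> carrier X" by simp
  \<comment> \<open>The zero vector puts \<open>0 / 0 = 0\<close> among the quotients.\<close>
  have "vnorm Y (T \<zero>\<^bsub>X\<^esub>) / vnorm X \<zero>\<^bsub>X\<^esub> = 0"
    using X.vnorm_eq_zero[OF zero] by simp
  then show ?thesis
    unfolding op_norm_def
    using cSUP_upper[OF zero bdd_above_op_norm_quotients[OF assms]] by (simp only:)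
qed

lemma vnorm_le_op_norm:
  assumes "normed_space X" and T: "T \<in> bounded_operators X Y" and x: "x \<in> carrier X"
  shows "vnorm Y (T x) \<le> op_norm X Y T * vnorm X x"
proof -
  interpret X: normed_space X by fact
  show ?thesis
  proof (cases "vnorm X x = 0")
    case True
    \<comment> \<open>Here the quotient carries no information, but boundedness forces \<open>T x\<close> to have norm zero.\<close>
    then show ?thesis
      using T x by (fastforce simp: bounded_operators_def)
  next
    case False
    then have "0 < vnorm X x"
      using X.vnorm_nonneg[OF x] by simp
    moreover have "vnorm Y (T x) / vnorm X x \<le> op_norm X Y T"
      unfolding op_norm_def
      by (rule cSUP_upper[OF x bdd_above_op_norm_quotients[OF assms(1,2)]])
    ultimately show ?thesis
      by (simp add: pos_divide_le_eq)
  qed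
qed

lemma vnorm_le_of_op_norm_le:
  assumes "normed_space X" and "T \<in> bounded_operators X Y" and "op_norm X Y T \<le> c"
    and "x \<in> carrier X" and "vnorm X x \<le> r"
  shows "vnorm Y (T x) \<le> c * r"
proof -
  interpret X: normed_space X by fact
  have "vnorm Y (T x) \<le> op_norm X Y T * vnorm X x"
    using assms by (intro vnorm_le_op_norm)
  also have "\<dots> \<le> c * r"
    using assms op_norm_nonneg[OF assms(1,2)] X.vnorm_nonneg by (intro mult_mono) auto
  finally show ?thesis .
qed

lemma op_norm_le:
  assumes "normed_space X" and "0 \<le> c"
    and bound: "\<And>x. x \<in> carrier X \<Longrightarrow> vnorm Y (T x) \<le> c * vnorm X x"
  shows "op_norm X Y T \<le> c"
proof -
  interpret X: normed_space X by fact
  have "vnorm Y (T x) / vnorm X x \<le> c" if x: "x \<in> carrier X" for x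
    \<comment> \<open>At the zero vector the quotient is zero, which is why \<open>c\<close> has to be nonnegative.\<close>
    using bound[OF x] X.vnorm_nonneg[OF x] \<open>0 \<le> c\<close>
    by (cases "vnorm X x = 0") (auto simp: pos_divide_le_eq)
  moreover have "carrier X \<noteq> {}"
    using X.zero_closed by blast
  ultimately show ?thesis
    unfolding op_norm_def by (intro cSUP_least)
qed

lemma (in normed_space) vnorm_le_add_minus:
  assumes v: "v \<in> carrier X" and w: "w \<in> carrier X"
  shows "vnorm X v \<le> vnorm X w + vnorm X (w \<ominus>\<^bsub>X\<^esub> v)"
proof -
  interpret D: Metric_space "carrier X" "vdist X"
    by (rule Metric_space_vdist)
  have minus_zero: "\<ominus>\<^bsub>X\<^esub> \<zero>\<^bsub>X\<^esub> = \<zero>\<^bsub>X\<^esub>"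
    by (rule M.minus_equality) auto
  have vdist_zero: "vdist X x \<zero>\<^bsub>X\<^esub> = vnorm X x" if "x \<in> carrier X" for x
    using that by (simp add: vdist_def a_minus_def minus_zero)
  have "vdist X v \<zero>\<^bsub>X\<^esub> \<le> vdist X v w + vdist X w \<zero>\<^bsub>X\<^esub>"
    using v w by (intro D.triangle) auto
  then show ?thesis
    using v w by (simp add: vdist_zero D.commute[of v w]) (simp add: vdist_def)
qed

theorem theorem3p4:
  fixes Z :: "('k::real_normed_field, 'a) normed_space"
    and Zn :: "nat \<Rightarrow> ('k, 'b) normed_space"
    and P :: "nat \<Rightarrow> 'a \<Rightarrow> 'b" and E :: "nat \<Rightarrow> 'b \<Rightarrow> 'a"
    and S :: "real \<Rightarrow> 'a \<Rightarrow> 'a" and Sn :: "nat \<Rightarrow> real \<Rightarrow> 'b \<Rightarrow> 'b"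
    and M \<omega> :: "nat \<Rightarrow> real" and \<mu>p \<mu>e :: real
  assumes "banach_space Z"
    and "approximation_sequence Z Zn P E"
    and "\<mu>p > 0" and "\<mu>e > 0"
    and "\<And>n. op_norm Z (Zn n) (P n) \<le> \<mu>p"
    and "\<And>n. op_norm (Zn n) Z (E n) \<le> \<mu>e"
    and "operator_semigroup Z S"
    and "\<And>n. operator_semigroup (Zn n) (Sn n)"
    and "\<And>n t. t \<ge> 0 \<Longrightarrow> op_norm (Zn n) (Zn n) (Sn n t) \<le> M n * exp (\<omega> n * t)"
    and "semigroups_converge Z Zn P E Sn S"
    and "Cauchy M" and "Cauchy \<omega>"
  shows "\<forall>t\<ge>0. op_norm Z Z (S t) \<le> (\<mu>p * \<mu>e * lim M) * exp (lim \<omega> * t)"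
proof (intro allI impI)
  fix t :: real
  assume t: "0 \<le> t"
  interpret Z: banach_space Z by fact
  have nZ: "normed_space Z" ..
  have bn: "banach_space (Zn n)" and Pn: "P n \<in> bounded_operators Z (Zn n)"
    and En: "E n \<in> bounded_operators (Zn n) Z" for n
    using assms(2) by (auto simp: approximation_sequence_def)
  have nZn: "normed_space (Zn n)" for n
    using bn by (rule banach_space.axioms)
  have Snt: "Sn n t \<in> bounded_operators (Zn n) (Zn n)" for n
    using assms(8) t by (auto simp: operator_semigroup_def)
  have St: "S t \<in> bounded_operators Z Z"
    using assms(7) t by (auto simp: operator_semigroup_def)
  define c where "c n = \<mu>e * (M n * exp (\<omega> n * t) * \<mu>p)" for n
  define C where "C = \<mu>p * \<mu>e * lim M * exp (lim \<omega> * t)"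
  have "M \<longlonglongrightarrow> lim M" and "\<omega> \<longlonglongrightarrow> lim \<omega>"
    using assms(11,12) by (auto simp: Cauchy_convergent_iff convergent_LIMSEQ_iff)
  then have "c \<longlonglongrightarrow> \<mu>e * (lim M * exp (lim \<omega> * t) * \<mu>p)"
    unfolding c_def by (intro tendsto_intros)
  then have c: "c \<longlonglongrightarrow> C"
    by (simp add: C_def mult_ac)
  have "0 \<le> c n" for n
  proof -
    have "0 \<le> M n * exp (\<omega> n * t)"
      using op_norm_nonneg[OF nZn Snt] assms(9)[OF t] by (rule order_trans)
    then show ?thesis
      unfolding c_def using \<open>\<mu>p > 0\<close> \<open>\<mu>e > 0\<close> by (simp only: mult_nonneg_nonneg less_imp_le)
  qed
  then have C_nonneg: "0 \<le> C"
    by (intro LIMSEQ_le_const[OF c]) auto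
  have "vnorm Z (S t z) \<le> C * vnorm Z z" if z: "z \<in> carrier Z" for z
  proof -
    define w where "w n = E n (Sn n t (P n z))" for n
    have Pz: "P n z \<in> carrier (Zn n)" for n
      using Pn z by (rule bounded_operators_closed)
    have SPz: "Sn n t (P n z) \<in> carrier (Zn n)" for n
      using Snt Pz by (rule bounded_operators_closed)
    have wZ: "w n \<in> carrier Z" for n
      unfolding w_def using En SPz by (rule bounded_operators_closed)
    have Sz: "S t z \<in> carrier Z"
      using St z by (rule bounded_operators_closed)
    have "vnorm (Zn n) (P n z \<ominus>\<^bsub>Zn n\<^esub> P n z) = 0" for n
    proof -
      interpret N: normed_space "Zn n" by (rule nZn)
      show ?thesis
        using Pz N.vnorm_eq_zero[of "\<zero>\<^bsub>Zn n\<^esub>"] by (simp add: a_minus_def N.M.r_neg)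
    qed
    then have "vectors_converge Zn P (\<lambda>n. P n z) z"
      by (simp add: vectors_converge_def)
    then have err: "(\<lambda>n. vnorm Z (w n \<ominus>\<^bsub>Z\<^esub> S t z)) \<longlonglongrightarrow> 0"
      unfolding w_def using assms(10) t z Pz by (simp add: semigroups_converge_def)
    have "vnorm Z (S t z) \<le> c n * vnorm Z z + vnorm Z (w n \<ominus>\<^bsub>Z\<^esub> S t z)" for n
    proof -
      have "vnorm Z (w n) \<le> \<mu>e * (M n * exp (\<omega> n * t) * (\<mu>p * vnorm Z z))"
        unfolding w_def
        by (intro vnorm_le_of_op_norm_le[OF nZn En assms(6)] SPz
            vnorm_le_of_op_norm_le[OF nZn Snt assms(9)[OF t]] Pz
            vnorm_le_of_op_norm_le[OF nZ Pn assms(5)] z order_refl)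
      then have "vnorm Z (w n) \<le> c n * vnorm Z z"
        by (simp add: c_def mult_ac)
      then show ?thesis
        using Z.vnorm_le_add_minus[OF Sz wZ[of n]] by linarith
    qed
    moreover have "(\<lambda>n. c n * vnorm Z z + vnorm Z (w n \<ominus>\<^bsub>Z\<^esub> S t z))
        \<longlonglongrightarrow> C * vnorm Z z + 0"
      by (intro tendsto_intros c err)
    ultimately have "vnorm Z (S t z) \<le> C * vnorm Z z + 0"
      by (intro LIMSEQ_le_const) auto
    then show ?thesis by simp
  qed
  then have "op_norm Z Z (S t) \<le> C"
    using nZ C_nonneg by (intro op_norm_le)
  then show "op_norm Z Z (S t) \<le> (\<mu>p * \<mu>e * lim M) * exp (lim \<omega> * t)"
    by (simp only: C_def)
qed

end
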